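(* Let $\gamma:\mathbb{S}\to\mathbb{R}^2$ be a smooth closed rotator for the curve diffusion flow, i.e. there is a constant $S\in\mathbb{R}$ with $-\kappa_{ss}=2S\langle\gamma_s,\gamma\rangle$ along $\gamma$. Then $\gamma$ is a standard round circle.
   Context: Curves are smooth and regular; $s$ is arc length, $\nu$ a smooth unit normal field, and $\kappa=\langle\gamma_{ss},\nu\rangle$. The curve diffusion flow is $\langle \partial_t\gamma,\nu\rangle=-\kappa_{ss}$. A rotator (a curve evolving purely by rotation) is a curve satisfying $-\kappa_{ss}\equiv2S\langle\gamma_s,\gamma\rangle$, where $S$ is constant along the curve (it may depend only on time along the flow). "Is a round circle" refers to the image of $\gamma$. *)

theory Defs
  imports "HOL-Analysis.Analysis"
begin

text \<open>
  The circle is \<^term>\<open>sphere (0::complex) 1\<close>. A map \<open>g\<close> on it is differentiated through its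
  lift \<open>g \<circ> cis\<close> along the covering \<^term>\<open>cis\<close> of the circle by the real line; the values of
  \<open>g\<close> off the circle play no role. The derivative operators below act on such lifts.
\<close>

definition vderiv :: "(real \<Rightarrow> 'a::real_normed_vector) \<Rightarrow> real \<Rightarrow> 'a" where
  "vderiv f = (\<lambda>t. vector_derivative f (at t))"

definition smooth :: "(real \<Rightarrow> 'a::real_normed_vector) \<Rightarrow> bool" where
  "smooth f \<longleftrightarrow> (\<forall>n t. (vderiv ^^ n) f differentiable (at t))"

definition regular :: "(real \<Rightarrow> 'a::real_normed_vector) \<Rightarrow> bool" where
  "regular c \<longleftrightarrow> (\<forall>t. vderiv c t \<noteq> 0)"

text \<open>
  The curve is not assumed to be parametrised by arc length: for a regular curve \<open>c\<close>, the
  arc length derivative of a function \<open>f\<close> along \<open>c\<close> is \<open>f\<^sub>s = f\<^sub>t / \<bar>c\<^sub>t\<bar>\<close>.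
\<close>

definition arclength_deriv ::
    "(real \<Rightarrow> real ^ 2) \<Rightarrow> (real \<Rightarrow> 'a::real_normed_vector) \<Rightarrow> real \<Rightarrow> 'a" where
  "arclength_deriv c f = (\<lambda>t. vderiv f t /\<^sub>R norm (vderiv c t))"

definition unit_normal_field :: "(real \<Rightarrow> real ^ 2) \<Rightarrow> (real \<Rightarrow> real ^ 2) \<Rightarrow> bool" where
  "unit_normal_field c \<nu> \<longleftrightarrow>
     smooth \<nu> \<and> (\<forall>t. norm (\<nu> t) = 1 \<and> arclength_deriv c c t \<bullet> \<nu> t = 0)"

definition curvature :: "(real \<Rightarrow> real ^ 2) \<Rightarrow> (real \<Rightarrow> real ^ 2) \<Rightarrow> real \<Rightarrow> real" where
  "curvature c \<nu> = (\<lambda>t. arclength_deriv c (arclength_deriv c c) t \<bullet> \<nu> t)"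

definition rotator :: "(real \<Rightarrow> real ^ 2) \<Rightarrow> (real \<Rightarrow> real ^ 2) \<Rightarrow> bool" where
  "rotator c \<nu> \<longleftrightarrow>
     (\<exists>S::real. \<forall>t. - arclength_deriv c (arclength_deriv c (curvature c \<nu>)) t
                   = 2 * S * (arclength_deriv c c t \<bullet> c t))"

definition round_circle :: "(real ^ 2) set \<Rightarrow> bool" where
  "round_circle A \<longleftrightarrow> (\<exists>p r. r > 0 \<and> A = sphere p r)"

end

theory Submission
  imports Defs
begin

text \<open>
  Write \<open>v = \<bar>c\<^sub>t\<bar>\<close>, \<open>k\<close> for the curvature and \<open>b = \<langle>c, \<nu>\<rangle>\<close> for the support function. The Frenet equation
  \<open>\<nu>\<^sub>t = -k c\<^sub>t\<close> gives \<open>b\<^sub>t = -k \<langle>c, c\<^sub>t\<rangle>\<close>, so the rotator equation yields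
  \<open>(k k\<^sub>s - 2 S b)\<^sub>t = v k\<^sub>s\<^sup>2 \<ge> 0\<close>. A periodic monotone function is constant, hence \<open>k\<^sub>s = 0\<close>.
  Since a closed curve has a critical point in every direction, \<open>k \<noteq> 0\<close>; then \<open>c + \<nu> / k\<close> is
  constant, so the curve lies on a circle, and maximising over the curve in a given direction
  shows that the whole circle is covered.
\<close>

text \<open>By Lagrange's identity the squared determinant of \<open>a\<close> and \<open>b\<close>
  is their Gram determinant, here a product of nonzero squared norms. The two equations for
  \<open>x\<close> thus form an invertible linear system.\<close>

lemma vector_eq_zero_real2:
  fixes a b x :: "real ^ 2"
  assumes "a \<noteq> 0" "b \<noteq> 0" "a \<bullet> b = 0" "x \<bullet> a = 0" "x \<bullet> b = 0"
  shows "x = 0"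
proof -
  let ?d = "a$1 * b$2 - a$2 * b$1"
  have "?d\<^sup>2 = (a \<bullet> a) * (b \<bullet> b) - (a \<bullet> b)\<^sup>2"
    by (simp add: inner_vec_def sum_2 power2_eq_square algebra_simps)
  then have "?d \<noteq> 0" using assms by auto
  moreover have "x$1 * ?d = 0" "x$2 * ?d = 0"
    using assms(4,5) by (simp_all add: inner_vec_def sum_2) algebra+
  ultimately show ?thesis by (simp add: vec_eq_iff forall_2)
qed

section \<open>Derivatives, periodicity and maxima on the line\<close>

lemma smooth_vderiv:
  "smooth f \<Longrightarrow> ((vderiv ^^ n) f has_vector_derivative (vderiv ^^ Suc n) f t) (at t)"
  by (simp add: smooth_def vderiv_def vector_derivative_works[symmetric])

lemma vderiv_eqI: "(f has_vector_derivative d) (at t) \<Longrightarrow> vderiv f t = d"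
  by (simp add: vderiv_def vector_derivative_at)

text \<open>Translation by the period preserves the predicate "has derivative \<open>d\<close>", so
  the choice operator behind \<open>vector_derivative\<close> returns the same value at both points,
  even where no derivative exists.\<close>

lemma vderiv_periodic:
  assumes "\<And>t. f (t + p) = f t"
  shows "vderiv f (t + p) = vderiv f t"
proof -
  have f: "(\<lambda>x. f (x + p)) = f" "(\<lambda>x. f (x + - p)) = f"
    using assms by (auto simp: fun_eq_iff) (metis diff_add_cancel)
  have shift: "((\<lambda>x. f (x + q)) has_vector_derivative d) (at s)"
    if "(f has_vector_derivative d) (at (s + q))" for d s q
  proof -
    have "((\<lambda>x. x + q) has_vector_derivative 1) (at s)"
      by (auto intro!: derivative_eq_intros)
    from vector_diff_chain_at[OF this that] show ?thesis by (simp add: o_def)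
  qed
  have "(f has_vector_derivative d) (at (t + p)) \<longleftrightarrow> (f has_vector_derivative d) (at t)" for d
    using shift[of d t p] shift[of d "t + p" "- p"] f by auto
  then show ?thesis by (simp add: vderiv_def vector_derivative_def)
qed

lemma arclength_deriv_periodic:
  assumes "\<And>t. c (t + p) = c t" "\<And>t. f (t + p) = f t"
  shows "arclength_deriv c f (t + p) = arclength_deriv c f t"
  unfolding arclength_deriv_def
  using vderiv_periodic[of c p, OF assms(1)] vderiv_periodic[of f p, OF assms(2)] by simp

lemma has_vector_derivative_zero_eq:
  assumes "\<And>t. (f has_vector_derivative 0) (at t)"
  shows "f x = f y"
  using assms by (metis has_vector_derivative_zero_constant convex_UNIV UNIV_I)

text \<open>Serves to differentiate pointwise identities: a function that simplifies to a constant
  turns its computed derivative into an equation.\<close>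

lemma has_real_derivative_const_eq_0:
  "((\<lambda>_. a) has_real_derivative d) (at t) \<Longrightarrow> d = 0"
  using DERIV_unique[OF _ DERIV_const] by blast

text \<open>Within one period of \<open>t\<close>, monotonicity squeezes \<open>F\<close> between
  \<open>F (t - p)\<close> and \<open>F (t + p)\<close>, both equal to \<open>F t\<close>; so
  \<open>F\<close> is constant near \<open>t\<close>.\<close>

lemma periodic_nondecreasing_deriv_zero:
  fixes F :: "real \<Rightarrow> real"
  assumes "p > 0" and per: "\<And>t. F (t + p) = F t"
    and F: "\<And>t. (F has_real_derivative F' t) (at t)" and "\<And>t. F' t \<ge> 0"
  shows "F' t = 0"
proof -
  have mono: "F x \<le> F y" if "x \<le> y" for x y
    using DERIV_nonneg_imp_nondecreasing[OF that, of F] F assms(4) by blast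
  have const: "F x = F t" if "x \<in> {t - p<..<t + p}" for x
    using mono[of x "t + p"] mono[of "t - p" x] per[of "t - p"] per[of t] that by simp
  have "((\<lambda>_. F t) has_real_derivative F' t) (at t)"
    by (rule has_field_derivative_transform_within_open[OF F[of t], of "{t - p<..<t + p}"])
      (use \<open>p > 0\<close> in \<open>auto intro: const\<close>)
  then show ?thesis by (rule has_real_derivative_const_eq_0)
qed

text \<open>The compact interval makes maxima along the closed curve available; the full range
  identifies the trace of the lift.\<close>

lemma cis_image: "cis ` {0..2 * pi} = sphere 0 1" "range cis = sphere 0 1"
proof -
  have "sphere 0 1 \<subseteq> cis ` {0..2 * pi}"
  proof
    fix z :: complex assume "z \<in> sphere 0 1"
    then have "z = cis (Arg2pi z)" using Arg2pi_eq[of z] by (simp add: cis_conv_exp)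
    then show "z \<in> cis ` {0..2 * pi}"
      using Arg2pi_ge_0[of z] Arg2pi_lt_2pi[of z] by (metis atLeastAtMost_iff imageI less_imp_le)
  qed
  then show "cis ` {0..2 * pi} = sphere 0 1" "range cis = sphere 0 1" by auto
qed

text \<open>The height in direction \<open>u\<close> attains its maximum over the compact interval.
  This interval already covers the whole trace, so the maximum is global on the line and therefore a
  critical point.\<close>

lemma directional_maximum:
  fixes c :: "real \<Rightarrow> 'a::real_inner"
  assumes c: "\<And>t. (c has_vector_derivative c' t) (at t)" and "range c = c ` {a..b}"
  obtains t where "c' t \<bullet> u = 0" "\<And>s. c s \<bullet> u \<le> c t \<bullet> u"
proof -
  have "continuous_on UNIV c"
    using c by (meson continuous_at_imp_continuous_on has_vector_derivative_continuous)
  then have "continuous_on {a..b} (\<lambda>t. c t \<bullet> u)"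
    by (intro continuous_intros) (auto intro: continuous_on_subset)
  moreover have "{a..b} \<noteq> {}" using assms(2) by (metis UNIV_not_empty image_is_empty)
  ultimately obtain t where "\<forall>s\<in>{a..b}. c s \<bullet> u \<le> c t \<bullet> u"
    using continuous_attains_sup[OF compact_Icc] by blast
  then have max: "c s \<bullet> u \<le> c t \<bullet> u" for s
    using assms(2) by (metis image_iff rangeI)
  have "((\<lambda>s. c s \<bullet> u) has_real_derivative c' t \<bullet> u) (at t)"
    using bounded_linear.has_vector_derivative[OF bounded_linear_inner_left c]
    by (simp add: has_real_derivative_iff_has_vector_derivative)
  then have "c' t \<bullet> u = 0"
    using DERIV_local_max[of _ _ t 1] max by auto
  then show thesis using max that by blast
qed

lemma has_real_derivative_inner:
  assumes "(f has_vector_derivative f') (at t)" "(g has_vector_derivative g') (at t)"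
  shows "((\<lambda>t. f t \<bullet> g t) has_real_derivative f' \<bullet> g t + f t \<bullet> g') (at t)"
  using bounded_bilinear.has_vector_derivative[OF bounded_bilinear_inner assms]
  by (simp add: has_real_derivative_iff_has_vector_derivative add.commute)

theorem proposition14:
  fixes \<gamma> \<nu> :: "complex \<Rightarrow> real ^ 2"
  assumes "smooth (\<gamma> \<circ> cis)" and "regular (\<gamma> \<circ> cis)"
    and "unit_normal_field (\<gamma> \<circ> cis) (\<nu> \<circ> cis)"
    and "rotator (\<gamma> \<circ> cis) (\<nu> \<circ> cis)"
  shows "round_circle (\<gamma> ` sphere 0 1)"
proof -
  define c where "c = \<gamma> \<circ> cis"
  define n where "n = \<nu> \<circ> cis"
  define c1 where "c1 = vderiv c"
  define c2 where "c2 = vderiv c1"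
  \<comment> \<open>Third derivatives occur because the derivative of the curvature contains
    \<open>c2\<close> and \<open>n2\<close> and is itself differentiated once more.\<close>
  define c3 where "c3 = vderiv c2"
  define n1 where "n1 = vderiv n"
  define n2 where "n2 = vderiv n1"
  define n3 where "n3 = vderiv n2"
  define v where "v t = norm (c1 t)" for t
  define k where "k = curvature c n"
  define k1 where "k1 = arclength_deriv c k"
  have smooth: "smooth c" "smooth n"
    using assms unfolding c_def n_def unit_normal_field_def by auto
  have c: "(c has_vector_derivative c1 t) (at t)" "(c1 has_vector_derivative c2 t) (at t)"
    "(c2 has_vector_derivative c3 t) (at t)" for t
    using smooth_vderiv[OF smooth(1), of 0 t] smooth_vderiv[OF smooth(1), of 1 t]
      smooth_vderiv[OF smooth(1), of 2 t]
    by (simp_all add: c1_def c2_def c3_def eval_nat_numeral)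
  have n: "(n has_vector_derivative n1 t) (at t)" "(n1 has_vector_derivative n2 t) (at t)"
    "(n2 has_vector_derivative n3 t) (at t)" for t
    using smooth_vderiv[OF smooth(2), of 0 t] smooth_vderiv[OF smooth(2), of 1 t]
      smooth_vderiv[OF smooth(2), of 2 t]
    by (simp_all add: n1_def n2_def n3_def eval_nat_numeral)
  have c1_nz: "c1 t \<noteq> 0" for t
    using assms(2) by (simp add: regular_def c1_def c_def)
  then have v_pos: "v t > 0" for t by (simp add: v_def)
  have v_sq: "v t * v t = c1 t \<bullet> c1 t" for t
    by (simp add: v_def dot_square_norm power2_eq_square)
  have n_unit: "n t \<bullet> n t = 1" and c1_n: "c1 t \<bullet> n t = 0" for t
    using assms(3) c1_nz[of t]
    by (auto simp: unit_normal_field_def n_def c_def c1_def arclength_deriv_def norm_eq_1)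
  have n1_n: "n1 t \<bullet> n t = 0" for t
    using has_real_derivative_const_eq_0[of 1 "n1 t \<bullet> n t + n t \<bullet> n1 t" t]
      has_real_derivative_inner[OF n(1) n(1), of t]
    by (simp add: n_unit inner_commute)
  have v_deriv: "(v has_real_derivative (c2 t \<bullet> c1 t) / v t) (at t)" for t
  proof -
    have "((\<lambda>t. c1 t \<bullet> c1 t) has_real_derivative 2 * (c2 t \<bullet> c1 t)) (at t)"
      using has_real_derivative_inner[OF c(2) c(2), of t] by (simp add: inner_commute)
    then have "((\<lambda>t. sqrt (c1 t \<bullet> c1 t)) has_real_derivative (c2 t \<bullet> c1 t) / v t) (at t)"
      using DERIV_chain2[OF DERIV_real_sqrt, of "\<lambda>t. c1 t \<bullet> c1 t" t "2 * (c2 t \<bullet> c1 t)" UNIV]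
        c1_nz[of t]
      by (simp add: v_def norm_eq_sqrt_inner field_simps)
    then show ?thesis by (simp add: v_def[abs_def] norm_eq_sqrt_inner)
  qed

  \<comment> \<open>Curvature and the Frenet equation\<close>
  have T: "arclength_deriv c c = (\<lambda>t. c1 t /\<^sub>R v t)"
    by (simp add: arclength_deriv_def c1_def v_def)
  \<comment> \<open>Differentiating \<open>(c1 t /\<^sub>R v t) \<bullet> n t = 0\<close> moves the
    derivative from the tangent to the normal. What remains is a quotient of inner products, free of
    norms and easy to differentiate.\<close>
  have k_eq: "k = (\<lambda>t. - (c1 t \<bullet> n1 t) / (c1 t \<bullet> c1 t))"
  proof
    fix t
    have "((\<lambda>t. inverse (v t)) has_real_derivative
        - (inverse (v t) * ((c2 t \<bullet> c1 t) / v t) * inverse (v t))) (at t)"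
      by (rule DERIV_inverse'[OF v_deriv]) (use v_pos[of t] in simp)
    then obtain d where d: "((\<lambda>t. c1 t /\<^sub>R v t) has_vector_derivative d) (at t)"
      by (rule that[OF has_vector_derivative_scaleR[OF _ c(2)]])
    have "((\<lambda>t. (c1 t /\<^sub>R v t) \<bullet> n t) has_real_derivative d \<bullet> n t + (c1 t /\<^sub>R v t) \<bullet> n1 t) (at t)"
      by (rule has_real_derivative_inner[OF d n(1)])
    then have "d \<bullet> n t + (c1 t /\<^sub>R v t) \<bullet> n1 t = 0"
      by (intro has_real_derivative_const_eq_0[of 0]) (simp add: c1_n)
    moreover have "k t = (d /\<^sub>R v t) \<bullet> n t"
      unfolding k_def curvature_def T arclength_deriv_def[of c "\<lambda>t. c1 t /\<^sub>R v t"] vderiv_eqI[OF d]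
      by (simp add: v_def c1_def)
    ultimately show "k t = - (c1 t \<bullet> n1 t) / (c1 t \<bullet> c1 t)"
      using v_pos[of t] by (simp add: v_sq[symmetric] field_simps) algebra
  qed
  have n1: "n1 t = - k t *\<^sub>R c1 t" for t
  proof -
    \<comment> \<open>Tested against the orthogonal pair \<open>c1 t\<close>, \<open>n t\<close>:
      the tangential part vanishes by \<open>k_eq\<close>, the normal part because \<open>n\<close>
      has unit length.\<close>
    have "n1 t + k t *\<^sub>R c1 t = 0"
      by (rule vector_eq_zero_real2[of "c1 t" "n t"])
        (use c1_nz[of t] c1_n[of t] n1_n[of t] n_unit[of t] in
          \<open>auto simp: k_eq inner_diff_right inner_commute\<close>)
    then show ?thesis by (simp add: add_eq_0_iff2)
  qed
  \<comment> \<open>The quotient rule applied to \<open>k_eq\<close>.\<close>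
  define k' where "k' t = - ((c2 t \<bullet> n1 t + c1 t \<bullet> n2 t) * (c1 t \<bullet> c1 t)
      - (c1 t \<bullet> n1 t) * (c2 t \<bullet> c1 t + c1 t \<bullet> c2 t)) / ((c1 t \<bullet> c1 t) * (c1 t \<bullet> c1 t))" for t
  have k: "(k has_real_derivative k' t) (at t)" for t
    unfolding k_eq k'_def using c1_nz[of t]
    by (auto intro!: derivative_eq_intros has_real_derivative_inner[OF c(2) n(2)]
        has_real_derivative_inner[OF c(2) c(2)] simp: divide_simps)
  have k1_eq: "k1 = (\<lambda>t. k' t / v t)"
    using vderiv_eqI[OF k[unfolded has_real_derivative_iff_has_vector_derivative]]
    by (simp add: k1_def arclength_deriv_def v_def[abs_def] c1_def fun_eq_iff divide_inverse)
  \<comment> \<open>Where no derivative exists, \<open>vderiv\<close> has an unspecified value;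
    differentiability of \<open>k1\<close> must be secured before the rotator equation can be read
    as a statement about its derivative.\<close>
  have "\<exists>d. (k' has_real_derivative d) (at t)" for t
    unfolding k'_def[abs_def]
    by (rule exI, (rule derivative_intros has_real_derivative_inner c n)+) (simp add: c1_nz)
  then have "\<exists>d. (k1 has_real_derivative d) (at t)" for t
    unfolding k1_eq using DERIV_divide[OF _ v_deriv] v_pos[of t] by (metis less_irrefl)
  then have k1_vderiv: "(k1 has_real_derivative vderiv k1 t) (at t)" for t
    by (metis has_real_derivative_iff_has_vector_derivative vderiv_eqI)
  obtain S where S: "- arclength_deriv c k1 t = 2 * S * ((c1 t /\<^sub>R v t) \<bullet> c t)" for t
    using assms(4) unfolding rotator_def c_def[symmetric] n_def[symmetric] k1_def k_def T by auto
  have k1: "(k1 has_real_derivative - 2 * S * (c1 t \<bullet> c t)) (at t)" for t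
  proof -
    \<comment> \<open>Both sides of the rotator equation carry the factor \<open>1 / v t\<close>,
      which cancels.\<close>
    have "vderiv k1 t = - 2 * S * (c1 t \<bullet> c t)"
      using S[of t] v_pos[of t]
      by (simp add: arclength_deriv_def v_def c1_def[symmetric] field_simps)
    then show ?thesis using k1_vderiv[of t] by simp
  qed

  \<comment> \<open>Periodicity and constancy of the curvature\<close>
  have per: "c (t + 2 * pi) = c t" "n (t + 2 * pi) = n t" for t
    by (simp_all add: c_def n_def cis.ctr)
  have k_per: "k (t + 2 * pi) = k t" for t
    using arclength_deriv_periodic[of c "2 * pi" "arclength_deriv c c"]
      arclength_deriv_periodic[of c "2 * pi" c] per
    by (simp add: k_def curvature_def)
  have k1_per: "k1 (t + 2 * pi) = k1 t" for t
    unfolding k1_def by (rule arclength_deriv_periodic) (simp_all add: per k_per)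
  have "v t * (k1 t)\<^sup>2 = 0" for t
  proof (rule periodic_nondecreasing_deriv_zero[of "2 * pi"
        "\<lambda>t. k t * k1 t - 2 * S * (c t \<bullet> n t)" "\<lambda>t. v t * (k1 t)\<^sup>2"])
    fix t
    have "k' t = v t * k1 t" using v_pos[of t] by (simp add: k1_eq)
    \<comment> \<open>The product contributes \<open>- 2 * S * k t * (c1 t \<bullet> c t)\<close>.
      The support function has derivative \<open>- k t * (c t \<bullet> c1 t)\<close>, since
      \<open>c1 t \<bullet> n t = 0\<close>, so the terms with \<open>S\<close> cancel.\<close>
    then show "((\<lambda>t. k t * k1 t - 2 * S * (c t \<bullet> n t)) has_real_derivative v t * (k1 t)\<^sup>2) (at t)"
      by (auto intro!: derivative_eq_intros k k1 has_real_derivative_inner[OF c(1) n(1)]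
          simp: c1_n n1 inner_commute power2_eq_square algebra_simps)
  qed (use v_pos in \<open>auto simp: per k_per k1_per less_imp_le\<close>)
  then have "k' t = 0" for t
    using v_pos by (simp add: k1_eq) (metis less_irrefl)
  then obtain K where K: "k t = K" for t
    using DERIV_isconst_all k by metis
  have range_c: "range c = \<gamma> ` sphere 0 1" "range c = c ` {0..2 * pi}"
    unfolding c_def image_comp[symmetric] cis_image by (rule refl)+
  have "K \<noteq> 0"
  proof
    assume "K = 0"
    then have "(n has_vector_derivative 0) (at t)" for t
      using n(1)[of t] by (simp add: n1 K)
    then have n_const: "n t = n 0" for t
      by (rule has_vector_derivative_zero_eq)
    \<comment> \<open>With a constant normal all tangents are parallel to \<open>c1 0\<close>; at a
      maximum of the height in that very direction the tangent is also orthogonal to it, hence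
      zero.\<close>
    obtain t where "c1 t \<bullet> c1 0 = 0"
      using directional_maximum[OF c(1) range_c(2)] by metis
    then have "c1 t = 0"
      using vector_eq_zero_real2[of "c1 0" "n 0" "c1 t"] c1_nz[of 0] c1_n[of 0] c1_n[of t]
        n_const[of t] n_unit[of 0] by fastforce
    then show False using c1_nz by blast
  qed
  \<comment> \<open>This is the centre of the osculating circle; it stands still because
    \<open>n1 t = - K *\<^sub>R c1 t\<close>.\<close>
  have "((\<lambda>t. c t + n t /\<^sub>R K) has_vector_derivative 0) (at t)" for t
    using \<open>K \<noteq> 0\<close> by (auto intro!: derivative_eq_intros c n simp: n1 K)
  from has_vector_derivative_zero_eq[OF this]
  obtain p where p: "c t + n t /\<^sub>R K = p" for t by blast

  \<comment> \<open>Covering of the whole circle\<close>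
  define r where "r = inverse \<bar>K\<bar>"
  have "r > 0" using \<open>K \<noteq> 0\<close> by (simp add: r_def)
  have cp: "c t - p = - (n t /\<^sub>R K)" for t
    using p[of t] by (simp add: algebra_simps)
  then have norm_cp: "norm (c t - p) = r" for t
    using n_unit[of t] by (simp add: r_def norm_eq_1)
  have "sphere p r \<subseteq> range c"
  proof
    fix q assume "q \<in> sphere p r"
    define u where "u = q - p"
    have u: "norm u = r" using \<open>q \<in> sphere p r\<close> by (simp add: u_def dist_norm norm_minus_commute)
    obtain t where t: "c1 t \<bullet> u = 0" "\<And>s. c s \<bullet> u \<le> c t \<bullet> u"
      using directional_maximum[OF c(1) range_c(2)] by metis
    define w where "w = c t - p"
    have w: "norm w = r" "w \<bullet> c1 t = 0"
      using norm_cp[of t] c1_n[of t] by (simp_all add: w_def cp inner_commute)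
    \<comment> \<open>The left side is \<open>u\<close> minus its projection onto \<open>w\<close>.
      It is orthogonal to \<open>w\<close>, and to \<open>c1 t\<close> because both \<open>u\<close>
      and \<open>w\<close> are, so \<open>u\<close> is a multiple of \<open>w\<close>.\<close>
    have "u - ((u \<bullet> w) / r\<^sup>2) *\<^sub>R w = 0"
      by (rule vector_eq_zero_real2[of w "c1 t"])
        (use w u t(1) c1_nz[of t] \<open>r > 0\<close> in \<open>auto simp: inner_diff_right dot_square_norm inner_commute\<close>)
    then obtain a where a: "u = a *\<^sub>R w" by simp
    then have "\<bar>a\<bar> = 1" using w u \<open>r > 0\<close> by simp
    then consider "u = w" | "u = - w" using a by (auto simp: abs_if split: if_splits)
    then show "q \<in> range c"
    proof cases
      case 1
      then have "q = c t" by (simp add: u_def w_def)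
      then show ?thesis by simp
    next
      case 2
      \<comment> \<open>Here the highest point in direction \<open>u\<close> lies antipodal to
        \<open>q\<close>, so every \<open>c s - p\<close> has inner product at least
        \<open>r\<^sup>2\<close> with \<open>w\<close>. Both vectors have length \<open>r\<close>,
        and equality in Cauchy-Schwarz forces \<open>c s - p = w\<close>: the curve would be
        constant, against regularity.\<close>
      have "c s = c t" for s
      proof -
        have "c t \<bullet> w \<le> c s \<bullet> w" using t(2)[of s] by (simp add: 2)
        moreover have "w \<bullet> w = (c t - p) \<bullet> w" by (simp add: w_def)
        ultimately have "w \<bullet> w \<le> (c s - p) \<bullet> w" by (simp add: inner_diff_left)
        moreover have "(norm (c s - p - w))\<^sup>2 = r\<^sup>2 + r\<^sup>2 - 2 * ((c s - p) \<bullet> w)"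
          using dot_norm_neg[of "c s - p" w] by (simp add: norm_cp w(1))
        ultimately have "(norm (c s - p - w))\<^sup>2 \<le> 0"
          by (simp add: dot_square_norm w(1))
        then show ?thesis by (simp add: w_def)
      qed
      then have "c = (\<lambda>_. c t)" by auto
      then have "c1 t = 0"
        using c(1)[of t] vector_derivative_unique_at has_vector_derivative_const by metis
      then show ?thesis using c1_nz by blast
    qed
  qed
  moreover have "range c \<subseteq> sphere p r"
    using norm_cp by (auto simp: dist_norm norm_minus_commute)
  ultimately have "\<gamma> ` sphere 0 1 = sphere p r" using range_c(1) by simp
  then show ?thesis using \<open>r > 0\<close> by (auto simp: round_circle_def)
qed

end
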